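(* Every optimal strategy for the exploitative player $X$ against the random player $R$ on path graphs has $X$ always guessing one of the numbers $2$ or $n-1$ when it is $X$'s turn in $MS(P_n)$, for $n\ge 2$. Moreover, with $P(\cdot)$, $Q(\cdot)$ and $a$ as defined in the context (in particular the limit $a$ exists), $$\lim_{n\to\infty}P(P_n)=\lim_{n\to\infty}Q(P_n)=2a,$$ and the value of $2a$ to ten decimal places is $0.5988890438$.
   Context: The misère tree search game $MS(T)$ is played by two players on a finite tree $T$. One vertex of $T$, chosen uniformly at random and unknown to both players, is poisoned. The players alternately guess a vertex of the current tree. If a player guesses the poisoned vertex, that player loses (and the other wins). Otherwise the guessed vertex is deleted from the current tree, it is revealed which of the resulting connected components contains the poisoned vertex, and the game continues on that component with the other player to move. (A player facing a one-vertex tree must guess it and loses.) $P_n$ is the path graph with $n$ vertices, identified in order with the integers $1,\dots,n$; after each guess the remaining range is relabelled as a shorter path. One player, $R$, makes every guess uniformly at random among the vertices of the current tree. The other player, $X$, knows this. A strategy for $X$ is optimal if it maximises $X$'s probability of winning against $R$ from every position in which $X$ is to move. $P(T)$ and $Q(T)$ denote the probability that $X$, playing optimally against $R$, wins $MS(T)$ when $X$ is the first player and the second player respectively. Let $p_n$ (respectively $q_n$) be the probability that $X$ wins $MS(P_n)$ against $R$ as first (respectively second) player when $X$ uses the strategy of always guessing the number $2$ (equivalently, by symmetry, $n-1$) on a current path of $n\ge2$ vertices (and the only vertex when one remains). Let $s_n=\sum_{i=1}^n i\,p_i$, let $a_n$ be defined by $s_n=a_n(n^2+7n+6)-2(n+1)$,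 and let $a=\lim_{n\to\infty}a_n$. *)

theory Defs
  imports "HOL-Probability.Probability"
begin

text \<open>
  A graph is given by a finite vertex set \<open>V\<close> and a symmetric adjacency relation \<open>E\<close>.  During the
  game the current tree is always an induced subgraph, so it is represented by its vertex set.
  The game below makes sense on every finite graph; it is meant for trees and used here for paths.
\<close>

definition linked :: "'a rel \<Rightarrow> 'a set \<Rightarrow> 'a \<Rightarrow> 'a \<Rightarrow> bool" where
  "linked E S u v \<longleftrightarrow> (u, v) \<in> (E \<inter> S \<times> S)\<^sup>*"

definition component :: "'a rel \<Rightarrow> 'a set \<Rightarrow> 'a \<Rightarrow> 'a set" where
  "component E S v = {w \<in> S. linked E S v w}"

definition position :: "'a set \<Rightarrow> 'a rel \<Rightarrow> 'a set \<Rightarrow> bool" where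
  "position V E S \<longleftrightarrow> S \<noteq> {} \<and> S \<subseteq> V \<and> (\<forall>u\<in>S. \<forall>v\<in>S. linked E S u v)"

datatype player = Exploiter | Randomizer

fun opponent :: "player \<Rightarrow> player" where
  "opponent Exploiter = Randomizer"
| "opponent Randomizer = Exploiter"

text \<open>A strategy of \<open>X\<close> may be randomised: it assigns to the current tree a distribution of guesses.\<close>

type_synonym 'a strategy = "'a set \<Rightarrow> 'a pmf"

fun guess :: "'a strategy \<Rightarrow> player \<Rightarrow> 'a set \<Rightarrow> 'a pmf" where
  "guess \<sigma> Exploiter S = \<sigma> S"
| "guess \<sigma> Randomizer S = pmf_of_set S"

text \<open>
  \<open>play E \<sigma> p S x\<close> is the distribution of the winner when player \<open>p\<close> is to move on the current tree
  \<open>S\<close> and \<open>x\<close> is the poisoned vertex.  The alternatives \<open>g \<notin> S\<close> and \<open>infinite S\<close> never occur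
  under legal play on a finite graph; they only make the recursion terminate unconditionally.
\<close>

function (sequential) play ::
  "'a rel \<Rightarrow> 'a strategy \<Rightarrow> player \<Rightarrow> 'a set \<Rightarrow> 'a \<Rightarrow> player pmf" where
  "play E \<sigma> p S x =
     bind_pmf (guess \<sigma> p S) (\<lambda>g.
       if g = x \<or> g \<notin> S \<or> infinite S then return_pmf (opponent p)
       else play E \<sigma> (opponent p) (component E (S - {g}) x) x)"
  by pat_completeness auto
termination
proof (relation "Wellfounded.measure (\<lambda>(E, \<sigma>, p, S, x). card S)", goal_cases)
  case (2 E \<sigma> p S x g)
  then have "component E (S - {g}) x \<subset> S" "finite S"
    by (auto simp: component_def)
  then show ?case
    by (simp add: psubset_card_mono)
qed simp

declare play.simps [simp del]

definition win_prob :: "'a rel \<Rightarrow> 'a strategy \<Rightarrow> player \<Rightarrow> 'a set \<Rightarrow> real" where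
  "win_prob E \<sigma> p S = pmf (bind_pmf (pmf_of_set S) (play E \<sigma> p S)) Exploiter"

definition legal_strategy :: "'a set \<Rightarrow> 'a rel \<Rightarrow> 'a strategy \<Rightarrow> bool" where
  "legal_strategy V E \<sigma> \<longleftrightarrow> (\<forall>S. position V E S \<longrightarrow> set_pmf (\<sigma> S) \<subseteq> S)"

definition optimal_strategy :: "'a set \<Rightarrow> 'a rel \<Rightarrow> 'a strategy \<Rightarrow> bool" where
  "optimal_strategy V E \<sigma> \<longleftrightarrow> legal_strategy V E \<sigma> \<and>
     (\<forall>\<tau> S. legal_strategy V E \<tau> \<longrightarrow> position V E S \<longrightarrow>
        win_prob E \<tau> Exploiter S \<le> win_prob E \<sigma> Exploiter S)"

text \<open>
  The common winning probability of all optimal strategies.  As \<open>THE\<close> is used, any non-trivial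
  fact about it entails that an optimal strategy exists and that the value is well defined.
\<close>

definition optimal_value :: "'a set \<Rightarrow> 'a rel \<Rightarrow> player \<Rightarrow> real" where
  "optimal_value V E p =
     (THE r. (\<exists>\<sigma>. optimal_strategy V E \<sigma>) \<and>
             (\<forall>\<sigma>. optimal_strategy V E \<sigma> \<longrightarrow> win_prob E \<sigma> p V = r))"

definition P_val :: "'a set \<Rightarrow> 'a rel \<Rightarrow> real" where
  "P_val V E = optimal_value V E Exploiter"

definition Q_val :: "'a set \<Rightarrow> 'a rel \<Rightarrow> real" where
  "Q_val V E = optimal_value V E Randomizer"

definition path_verts :: "nat \<Rightarrow> nat set" where
  "path_verts n = {1..n}"

definition path_adj :: "nat \<Rightarrow> nat rel" where
  "path_adj n = {(i, j) \<in> path_verts n \<times> path_verts n. j = Suc i \<or> i = Suc j}"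

text \<open>The number that vertex \<open>v\<close> receives when the current range \<open>S\<close> is relabelled as \<open>1, \<dots>, card S\<close>.\<close>

definition label :: "nat set \<Rightarrow> nat \<Rightarrow> nat" where
  "label S v = card {u \<in> S. u \<le> v}"

definition guess_two :: "nat strategy" where
  "guess_two S = return_pmf (THE v. v \<in> S \<and> label S v = (if card S \<ge> 2 then 2 else 1))"

definition p_seq :: "nat \<Rightarrow> real" where
  "p_seq n = win_prob (path_adj n) guess_two Exploiter (path_verts n)"

definition s_seq :: "nat \<Rightarrow> real" where
  "s_seq n = (\<Sum>i=1..n. real i * p_seq i)"

text \<open>This is \<open>s_seq n = a_seq n * (n\<^sup>2 + 7 * n + 6) - 2 * (n + 1)\<close> solved for \<open>a_seq n\<close>.\<close>

definition a_seq :: "nat \<Rightarrow> real" where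
  "a_seq n = (s_seq n + 2 * (real n + 1)) / ((real n)\<^sup>2 + 7 * real n + 6)"

end

theory Submission
  imports Defs
begin

text \<open>
  Multiply all winning probabilities by the number of vertices.  Write \<open>A n\<close> and \<open>B n\<close> for \<open>n\<close> times
  the probability that \<open>X\<close>, always guessing \<open>2\<close>, wins on a path of \<open>n\<close> vertices with \<open>X\<close>, respectively
  \<open>R\<close>, to move.  A guess of \<open>X\<close> that leaves paths of lengths \<open>l\<close> and \<open>r\<close> is worth \<open>B l + B r\<close>, so that
  \<open>A n = B 1 + B (n - 2) = 1 + B (n - 2)\<close> for \<open>n \<ge> 2\<close>, and averaging over the guesses of \<open>R\<close> gives
  \<open>n * B n = n + 2 * (A 0 + \<dots> + A (n - 1))\<close>.  These equations define \<open>move_score\<close> (for \<open>A\<close>) and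
  \<open>wait_score\<close> (for \<open>B\<close>), and the claim about optimal play becomes the inequality
  \<open>B l + B r < 1 + B (l + r - 1)\<close> whenever \<open>l \<noteq> 1\<close>, \<open>r \<noteq> 1\<close> and \<open>l + r \<ge> 1\<close>.

  Everything is controlled by the increments \<open>step n = B (n + 1) - B n\<close>.  They satisfy
  \<open>(m + 4) * step (m + 3) = (m + 2) * step (m + 2) + 2 * step m\<close> (\<open>step_rec\<close>): each increment is a
  convex combination of two of the three preceding ones.  So any bounds on three consecutive
  increments hold for all later ones (\<open>step_bounds\<close>), and since the weight of the older term tends
  to \<open>0\<close>, the increments converge very fast, to \<open>limit_step\<close>.  Exact rational values of the first
  28 increments give the decimal expansion of this limit.

  For \<open>2 \<le> l \<le> r\<close> the inequality compares the sum of the \<open>l - 1\<close> increments that follow \<open>step 0\<close> with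
  a sum of \<open>l - 1\<close> later increments.  The later ones are close to the limit, while the earlier ones
  begin with \<open>step 1 = 0\<close>, a deficit that outweighs the excess of those early increments that
  lie above the limit (\<open>wait_score_split_less\<close>).

  By induction along the game, the scores bound what any legal strategy achieves, and \<open>guess_two\<close>
  attains the bound (\<open>win_mass_le_scores\<close>, \<open>win_mass_guess_two\<close>).  Hence a strategy is optimal exactly
  if it attains \<open>move_score\<close> everywhere, and then strictness of the inequality excludes every other
  guess.  Finally \<open>2 * a_seq n = (B (n + 1) + 3) / (n + 6)\<close>, \<open>P = A n / n\<close> and \<open>Q = B n / n\<close> all
  tend to the limiting increment.
\<close>

section \<open>The scores of the strategy that guesses two\<close>

text \<open>
  The recursion is the difference of the relation \<open>n * B n = n + 2 * (A 0 + \<dots> + A (n - 1))\<close> at consecutive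
  arguments, with \<open>A n\<close> replaced by \<open>1 + B (n - 2)\<close>.  The value \<open>0\<close> for the empty path is the correct
  contribution of an empty side of a guess.
\<close>

fun wait_score :: "nat \<Rightarrow> real" where
  "wait_score 0 = 0"
| "wait_score (Suc 0) = 1"
| "wait_score (Suc (Suc 0)) = 1"
| "wait_score (Suc (Suc (Suc n))) =
     ((real n + 2) * wait_score (Suc (Suc n)) + 3 + 2 * wait_score n) / (real n + 3)"

definition move_score :: "nat \<Rightarrow> real" where
  "move_score n = (if n < 2 then 0 else 1 + wait_score (n - 2))"

definition step :: "nat \<Rightarrow> real" where
  "step n = wait_score (Suc n) - wait_score n"

lemma wait_score_add: "wait_score (m + k) = wait_score m + (\<Sum>i<k. step (m + i))"
  by (induction k) (simp_all add: step_def)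

lemma wait_score_eq_sum: "real n * wait_score n = real n + 2 * (\<Sum>i<n. move_score i)"
proof (induction n)
  case 0
  then show ?case by simp
next
  case (Suc n)
  consider "n = 0" | "n = 1" | m where "n = Suc (Suc m)"
    by (metis One_nat_def not0_implies_Suc)
  then show ?case
  proof cases
    case 3
    have "real (Suc n) * wait_score (Suc n) = real n * wait_score n + 3 + 2 * wait_score (n - 2)"
      using 3 by (simp add: field_simps)
    then show ?thesis
      using Suc 3 by (simp add: move_score_def)
  qed (simp_all add: move_score_def numeral_2_eq_2)
qed

lemma step_0: "step 0 = 1" and step_1: "step 1 = 0" and step_2: "step 2 = 2 / 3"
  by (simp_all add: step_def numeral_2_eq_2)

text \<open>
  Solving the recursion of \<open>wait_score\<close> for its oldest term expresses the score itself through three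
  increments.  No sum over increments is left, so estimates of the increments carry over to the score without
  accumulating errors.
\<close>

lemma wait_score_eq_steps:
  "wait_score m = (real m + 3) * step (m + 2) + step (m + 1) + step m - 3"
  by (simp add: step_def field_simps)

text \<open>
  The difference of \<open>wait_score_eq_steps\<close> at consecutive arguments.  The weights \<open>m + 2\<close> and \<open>2\<close> add up to the
  denominator, which makes this a convex combination.
\<close>

lemma step_rec: "step (m + 3) = ((real m + 2) * step (m + 2) + 2 * step m) / (real m + 4)"
proof -
  have "step m = (real m + 4) * step (m + 3) + step (m + 2) + step (m + 1)
      - ((real m + 3) * step (m + 2) + step (m + 1) + step m)"
    using wait_score_eq_steps[of "Suc m"] wait_score_eq_steps[of m]
    by (simp add: step_def[of m] numeral_eq_Suc algebra_simps)
  then show ?thesis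
    by (simp add: field_simps)
qed

lemma convex_combination_bounds:
  fixes x y u v l h :: real
  assumes "0 \<le> u" "0 \<le> v" "0 < u + v" "l \<le> x" "x \<le> h" "l \<le> y" "y \<le> h"
  shows "l \<le> (u * x + v * y) / (u + v)" "(u * x + v * y) / (u + v) \<le> h"
proof -
  have "(u + v) * l \<le> u * x + v * y" "u * x + v * y \<le> (u + v) * h"
    using assms by (auto simp: distrib_right intro!: add_mono mult_left_mono)
  then show "l \<le> (u * x + v * y) / (u + v)" "(u * x + v * y) / (u + v) \<le> h"
    using assms(3) by (simp_all add: field_simps)
qed

lemma step_bounds:
  assumes "l \<le> step m" "l \<le> step (m + 1)" "l \<le> step (m + 2)"
    and "step m \<le> h" "step (m + 1) \<le> h" "step (m + 2) \<le> h"
    and "m \<le> k"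
  shows "l \<le> step k \<and> step k \<le> h"
  using assms(7)
proof (induction k rule: less_induct)
  case (less k)
  show ?case
  proof (cases "k < m + 3")
    case True
    then have "k = m \<or> k = m + 1 \<or> k = m + 2"
      using less.prems by auto
    then show ?thesis using assms by auto
  next
    case False
    then obtain j where k: "k = j + 3" "m \<le> j"
      using less.prems that[of "k - 3"] by force
    have "l \<le> step j \<and> step j \<le> h" "l \<le> step (j + 2) \<and> step (j + 2) \<le> h"
      using less.IH[of j] less.IH[of "j + 2"] k by auto
    then show ?thesis
      using convex_combination_bounds[of "real j + 2" 2 l "step (j + 2)" h "step j"] k
      by (simp add: step_rec add.assoc)
  qed
qed

text \<open>
  Exact values up to a window of three increments that is narrow enough to determine ten decimal places of the
  limit.
\<close>

lemma step_values:
  shows "step 3 = 5 / 6"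
    and "step 4 = 1 / 2"
    and "step 5 = 5 / 9"
    and "step 6 = 40 / 63"
    and "step 7 = 101 / 168"
    and "step 8 = 383 / 648"
    and "step 9 = 3401 / 5670"
    and "step 10 = 8317 / 13860"
    and "step 11 = 179197 / 299376"
    and "step 12 = 151319 / 252720"
    and "step 13 = 13597741 / 22702680"
    and "step 14 = 23532559 / 39293100"
    and "step 15 = 1398466513 / 2335132800"
    and "step 16 = 11094648727 / 18525386880"
    and "step 17 = 187222513061 / 312615903600"
    and "step 18 = 836993442563 / 1397576980800"
    and "step 19 = 4517107419191 / 7542478944000"
    and "step 20 = 314533369498793 / 525194718048000"
    and "step 21 = 505672872189773 / 844351508246400"
    and "step 22 = 2249943258364663 / 3756861621513000"
    and "step 23 = 149946632008366007 / 250374645585792000"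
    and "step 24 = 19721241834244378607 / 32929708821609600000"
    and "step 25 = 491387608928147046361 / 820498578138439200000"
    and "step 26 = 23941291020436406069 / 39976171325842752000"
    and "step 27 = 171456476464967859473797 / 286290888495073862400000"
proof -
  show s3: "step 3 = 5 / 6"
    using step_rec[of 0] by (simp add: step_0 step_2 del: add_2_eq_Suc')
  show s4: "step 4 = 1 / 2"
    using step_rec[of 1] by (simp add: s3 step_1[simplified] del: add_2_eq_Suc')
  show s5: "step 5 = 5 / 9"
    using step_rec[of 2] by (simp add: s4 step_2 del: add_2_eq_Suc')
  show s6: "step 6 = 40 / 63"
    using step_rec[of 3] by (simp add: s5 s3 del: add_2_eq_Suc')
  show s7: "step 7 = 101 / 168"
    using step_rec[of 4] by (simp add: s6 s4 del: add_2_eq_Suc')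
  show s8: "step 8 = 383 / 648"
    using step_rec[of 5] by (simp add: s7 s5 del: add_2_eq_Suc')
  show s9: "step 9 = 3401 / 5670"
    using step_rec[of 6] by (simp add: s8 s6 del: add_2_eq_Suc')
  show s10: "step 10 = 8317 / 13860"
    using step_rec[of 7] by (simp add: s9 s7 del: add_2_eq_Suc')
  show s11: "step 11 = 179197 / 299376"
    using step_rec[of 8] by (simp add: s10 s8 del: add_2_eq_Suc')
  show s12: "step 12 = 151319 / 252720"
    using step_rec[of 9] by (simp add: s11 s9 del: add_2_eq_Suc')
  show s13: "step 13 = 13597741 / 22702680"
    using step_rec[of 10] by (simp add: s12 s10 del: add_2_eq_Suc')
  show s14: "step 14 = 23532559 / 39293100"
    using step_rec[of 11] by (simp add: s13 s11 del: add_2_eq_Suc')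
  show s15: "step 15 = 1398466513 / 2335132800"
    using step_rec[of 12] by (simp add: s14 s12 del: add_2_eq_Suc')
  show s16: "step 16 = 11094648727 / 18525386880"
    using step_rec[of 13] by (simp add: s15 s13 del: add_2_eq_Suc')
  show s17: "step 17 = 187222513061 / 312615903600"
    using step_rec[of 14] by (simp add: s16 s14 del: add_2_eq_Suc')
  show s18: "step 18 = 836993442563 / 1397576980800"
    using step_rec[of 15] by (simp add: s17 s15 del: add_2_eq_Suc')
  show s19: "step 19 = 4517107419191 / 7542478944000"
    using step_rec[of 16] by (simp add: s18 s16 del: add_2_eq_Suc')
  show s20: "step 20 = 314533369498793 / 525194718048000"
    using step_rec[of 17] by (simp add: s19 s17 del: add_2_eq_Suc')
  show s21: "step 21 = 505672872189773 / 844351508246400"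
    using step_rec[of 18] by (simp add: s20 s18 del: add_2_eq_Suc')
  show s22: "step 22 = 2249943258364663 / 3756861621513000"
    using step_rec[of 19] by (simp add: s21 s19 del: add_2_eq_Suc')
  show s23: "step 23 = 149946632008366007 / 250374645585792000"
    using step_rec[of 20] by (simp add: s22 s20 del: add_2_eq_Suc')
  show s24: "step 24 = 19721241834244378607 / 32929708821609600000"
    using step_rec[of 21] by (simp add: s23 s21 del: add_2_eq_Suc')
  show s25: "step 25 = 491387608928147046361 / 820498578138439200000"
    using step_rec[of 22] by (simp add: s24 s22 del: add_2_eq_Suc')
  show s26: "step 26 = 23941291020436406069 / 39976171325842752000"
    using step_rec[of 23] by (simp add: s25 s23 del: add_2_eq_Suc')
  show s27: "step 27 = 171456476464967859473797 / 286290888495073862400000"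
    using step_rec[of 24] by (simp add: s26 s24 del: add_2_eq_Suc')
qed

text \<open>
  The newest term moves only by the weight of the older one, which decays like \<open>2 / m\<close>.
\<close>

lemma step_change:
  "\<bar>step (m + 3) - step (m + 2)\<bar> = 2 / (real m + 4) * \<bar>step m - step (m + 2)\<bar>"
proof -
  have "step (m + 3) - step (m + 2) = 2 / (real m + 4) * (step m - step (m + 2))"
    by (simp add: step_rec field_simps)
  then show ?thesis
    by (simp only: abs_mult) simp
qed

lemma step_ge:
  "2 \<le> k \<Longrightarrow> 1 / 2 \<le> step k" "5 \<le> k \<Longrightarrow> 5 / 9 \<le> step k" "6 \<le> k \<Longrightarrow> 383 / 648 \<le> step k"
  subgoal by (rule conjunct1[OF step_bounds[of "1 / 2" 2 "1" k]])
      (simp_all add: step_2 step_values del: add_2_eq_Suc')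
  subgoal by (rule conjunct1[OF step_bounds[of "5 / 9" 5 "1" k]])
      (simp_all add: step_2 step_values del: add_2_eq_Suc')
  subgoal by (rule conjunct1[OF step_bounds[of "383 / 648" 6 "1" k]])
      (simp_all add: step_2 step_values del: add_2_eq_Suc')
  done

lemma step_le:
  "2 \<le> k \<Longrightarrow> step k \<le> 5 / 6" "5 \<le> k \<Longrightarrow> step k \<le> 40 / 63" "7 \<le> k \<Longrightarrow> step k \<le> 101 / 168"
  subgoal by (rule conjunct2[OF step_bounds[of "0" 2 "5 / 6" k]])
      (simp_all add: step_2 step_values del: add_2_eq_Suc')
  subgoal by (rule conjunct2[OF step_bounds[of "0" 5 "40 / 63" k]])
      (simp_all add: step_2 step_values del: add_2_eq_Suc')
  subgoal by (rule conjunct2[OF step_bounds[of "0" 7 "101 / 168" k]])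
      (simp_all add: step_2 step_values del: add_2_eq_Suc')
  done

lemma step_change_le:
  assumes "7 \<le> k"
  shows "\<bar>step (k + 1) - step k\<bar> \<le> 10 / (63 * (real k + 2))"
proof -
  obtain m where k: "k = m + 2" "5 \<le> m"
    using assms that[of "k - 2"] by simp
  have "\<bar>step m - step (m + 2)\<bar> \<le> 5 / 63"
    using step_ge(2)[of m] step_le(2)[of m] step_ge(2)[of "m + 2"] step_le(2)[of "m + 2"] k
    unfolding abs_le_iff by linarith
  then have "2 / (real m + 4) * \<bar>step m - step (m + 2)\<bar> \<le> 2 / (real m + 4) * (5 / 63)"
    by (intro mult_left_mono) auto
  then have "\<bar>step (m + 3) - step (m + 2)\<bar> \<le> 2 / (real m + 4) * (5 / 63)"
    by (simp only: step_change)
  then show ?thesis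
    using k by (simp add: numeral_3_eq_3 algebra_simps)
qed

section \<open>Guessing two is the only good guess\<close>

lemma wait_score_small:
  "wait_score 2 = 1" "wait_score 3 = 5 / 3" "wait_score 4 = 5 / 2" "wait_score 5 = 3"
  "wait_score 6 = 32 / 9"
  by (simp_all add: eval_nat_numeral)

text \<open>
  Subtracting \<open>wait_score j\<close>, the claim compares \<open>wait_score i - 1\<close> with a sum of \<open>i - 1\<close> increments
  whose indices are at least \<open>j \<ge> i\<close>.  For small \<open>i\<close> lower bounds on the increments suffice.  For
  large \<open>i\<close> the increments from index \<open>i\<close> on lie in an interval of radius \<open>d = O(1 / i)\<close> around
  \<open>c = step (i + 1)\<close>.  So the sum is about \<open>(i - 1) * c\<close> and \<open>wait_score i - 1\<close> is about
  \<open>(i + 5) * c - 4\<close>, which is smaller by \<open>4 - 6 * c\<close>.  Since \<open>c \<le> 101 / 168\<close>, this is more than the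
  total error \<open>2 * (i + 2) * d = 20 / 63\<close>.
\<close>

lemma wait_score_split_less_ordered:
  assumes "2 \<le> i" "i \<le> j"
  shows "wait_score i + wait_score j < 1 + wait_score (i + j - 1)"
proof -
  have eq: "wait_score (i + j - 1) = wait_score j + (\<Sum>t<i - 1. step (j + t))"
    using wait_score_add[of j "i - 1"] assms by (simp add: add.commute)
  have ge: "real (i - 1) * l \<le> (\<Sum>t<i - 1. step (j + t))" if "\<And>k. j \<le> k \<Longrightarrow> l \<le> step k" for l
    using sum_bounded_below[of "{..<i - 1}" l "\<lambda>t. step (j + t)"] that by simp
  consider "i = 2" | "i = 3" | "i = 4" | "i = 5" | "i = 6" | "7 \<le> i"
    using assms(1) by linarith
  then have "wait_score i - 1 < (\<Sum>t<i - 1. step (j + t))"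
  proof cases
    case 1
    then show ?thesis
      using step_ge(1)[of j] assms by (simp add: wait_score_small)
  next
    case 2
    then show ?thesis
      using ge[of "1 / 2"] step_ge(1) assms by (simp add: wait_score_small)
  next
    case 3
    have "(\<Sum>t<i - 1. step (j + t)) = step j + step (j + 1) + step (j + 2)"
      using 3 by (simp add: eval_nat_numeral)
    then show ?thesis
      using step_ge(1)[of j] step_ge(2)[of "j + 1"] step_ge(2)[of "j + 2"] 3 assms
      by (simp add: wait_score_small del: add_2_eq_Suc')
  next
    case 4
    then show ?thesis
      using ge[of "5/9"] step_ge(2) assms by (simp add: wait_score_small)
  next
    case 5
    then show ?thesis
      using ge[of "383/648"] step_ge(3) assms by (simp add: wait_score_small)
  next
    case 6
    \<comment> \<open>All increments from index \<open>i\<close> on lie within \<open>d\<close> of \<open>c\<close>: two changes of at most \<open>d\<close> separate the three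
      increments of the window at \<open>i\<close>, and \<open>c\<close> is the middle one.\<close>
    define c where "c = step (i + 1)"
    define d where "d = 10 / (63 * (real i + 2))"
    have d: "0 \<le> d" "d * (real i + 2) = 10 / 63"
      by (simp_all add: d_def field_simps)
    have lo: "\<bar>c - step i\<bar> \<le> d"
      using step_change_le[OF 6] by (simp add: c_def d_def)
    have "\<bar>step (i + 2) - c\<bar> \<le> 10 / (63 * (real (i + 1) + 2))"
      using step_change_le[of "i + 1"] 6 by (simp add: c_def)
    also have "\<dots> \<le> d"
      unfolding d_def by (intro divide_left_mono) auto
    finally have hi: "\<bar>step (i + 2) - c\<bar> \<le> d" .
    have window: "c - d \<le> step i" "c - d \<le> step (i + 1)" "c - d \<le> step (i + 2)"
      "step i \<le> c + d" "step (i + 1) \<le> c + d" "step (i + 2) \<le> c + d"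
      using lo hi d(1) unfolding abs_le_iff c_def by linarith+
    have "c - d \<le> step k" if "j \<le> k" for k
      using step_bounds[OF window, of k] that assms(2) by simp
    then have "(real i - 1) * (c - d) \<le> (\<Sum>t<i - 1. step (j + t))"
      using ge[of "c - d"] 6 by (simp add: of_nat_diff)
    moreover have "wait_score i \<le> (real i + 5) * (c + d) - 3"
    proof -
      have "(real i + 3) * step (i + 2) \<le> (real i + 3) * (c + d)"
        using window(6) by (intro mult_left_mono) auto
      then have "wait_score i \<le> (real i + 3) * (c + d) + (c + d) + (c + d) - 3"
        unfolding wait_score_eq_steps[of i] using window(4,5) by (intro diff_right_mono add_mono)
      also have "\<dots> = (real i + 5) * (c + d) - 3"
        by (simp add: algebra_simps)
      finally show ?thesis .
    qed
    moreover have "c \<le> 101 / 168"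
      using step_le(3)[of "i + 1"] 6 by (simp add: c_def)
    moreover have "(real i - 1) * (c - d) - ((real i + 5) * (c + d) - 3)
        = 3 - 6 * c - 2 * (d * (real i + 2))"
      by (simp add: field_simps)
    ultimately show ?thesis
      using d by linarith
  qed
  then show ?thesis
    using eq by simp
qed

lemma wait_score_split_less:
  assumes "2 \<le> i" "2 \<le> j"
  shows "wait_score i + wait_score j < 1 + wait_score (i + j - 1)"
  using wait_score_split_less_ordered[of i j] wait_score_split_less_ordered[of j i] assms
  by (cases "i \<le> j") (simp_all add: add.commute)

lemma step_less_1: "1 \<le> k \<Longrightarrow> step k < 1"
  using step_le(1)[of k] step_1 by (cases "k = 1") auto

text \<open>
  With \<open>l\<close> and \<open>r\<close> the sizes of the two sides of a guess: it is at most as good as the guess \<open>2\<close>, and strictly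
  worse unless one side is a single vertex.  If a side is empty, the claim is that an increment is below \<open>1\<close>;
  the only increment that reaches \<open>1\<close>, \<open>step 0\<close>, belongs to the path of two vertices, where both guesses are
  equally good.
\<close>

lemma wait_score_split_le_move_score: "wait_score l + wait_score r \<le> move_score (l + r + 1)"
  and wait_score_split_less_move_score:
    "l \<noteq> 1 \<Longrightarrow> r \<noteq> 1 \<Longrightarrow> 1 \<le> l + r \<Longrightarrow> wait_score l + wait_score r < move_score (l + r + 1)"
proof -
  have move: "move_score (l + r + 1) = 1 + wait_score (l + r - 1)" if "1 \<le> l + r" for l r
    using that by (auto simp: move_score_def)
  have end_vertex: "wait_score k < move_score (k + 1)" if "2 \<le> k" for k
  proof -
    have "1 \<le> k - 1" using that by simp
    from step_less_1[OF this] show ?thesis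
      using move[of k 0] that by (simp add: step_def)
  qed
  show less: "wait_score l + wait_score r < move_score (l + r + 1)"
    if sides: "l \<noteq> 1" "r \<noteq> 1" "1 \<le> l + r" for l r
  proof -
    consider "l = 0" "2 \<le> r" | "r = 0" "2 \<le> l" | "2 \<le> l" "2 \<le> r"
      using sides by linarith
    then show ?thesis
      by cases (use end_vertex[of l] end_vertex[of r] wait_score_split_less[of l r] move[of l r]
        in auto)
  qed
  show "wait_score l + wait_score r \<le> move_score (l + r + 1)"
  proof -
    consider "l = 1" | "r = 1" | "l = 0" "r = 0" | "l \<noteq> 1" "r \<noteq> 1" "1 \<le> l + r"
      by linarith
    then show ?thesis
    proof cases
      case 4
      from less[OF this] show ?thesis by simp
    qed (use move[of l r] in \<open>auto simp: move_score_def\<close>)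
  qed
qed

section \<open>The limiting increment\<close>

text \<open>
  The changes \<open>f m = step (m + 1) - step m\<close> satisfy
  \<open>\<bar>f (m + 2)\<bar> \<le> 2 / (m + 4) * (\<bar>f m\<bar> + \<bar>f (m + 1)\<bar>)\<close>.  From \<open>m = 4\<close> on, the factor is at most
  \<open>1 / 4\<close>, and \<open>(3 / 4)\<^sup>2\<close> is larger than \<open>(1 + 3 / 4) / 4\<close>.
\<close>

lemma step_change_geometric:
  assumes "4 \<le> k"
  shows "\<bar>step (k + 1) - step k\<bar> \<le> (3 / 4) ^ k"
  using assms
proof (induction k rule: less_induct)
  case (less k)
  consider "k = 4" | "k = 5" | m where "k = m + 2" "4 \<le> m"
    using less.prems that(3)[of "k - 2"] by fastforce
  then show ?case
  proof cases
    case 3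
    let ?f = "\<lambda>n. \<bar>step (n + 1) - step n\<bar>"
    have "?f k = 2 / (real m + 4) * \<bar>step m - step (m + 2)\<bar>"
      using step_change[of m] 3 by (simp add: numeral_3_eq_3)
    also have "\<dots> \<le> 1 / 4 * (?f m + ?f (m + 1))"
      using 3 by (intro mult_mono) (auto simp: field_simps)
    also have "\<dots> \<le> 1 / 4 * ((3 / 4) ^ m + (3 / 4) ^ (m + 1))"
      using less.IH[of m] less.IH[of "m + 1"] 3 by (intro mult_left_mono add_mono) auto
    also have "\<dots> \<le> (3 / 4) ^ k"
      using 3 by (simp add: power2_eq_square)
    finally show ?thesis .
  qed (simp_all add: step_values eval_nat_numeral(1) power_numeral_reduce)
qed

lemma convergent_step: "convergent step"
proof -
  have "summable (\<lambda>k. step (Suc k) - step k)"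
  proof (rule summable_comparison_test)
    show "\<exists>N. \<forall>n\<ge>N. norm (step (Suc n) - step n) \<le> (3 / 4) ^ n"
      using step_change_geometric by auto
  qed (simp add: summable_geometric)
  then have "convergent (\<lambda>n. step n - step 0)"
    by (simp add: summable_iff_convergent sum_lessThan_telescope)
  then show ?thesis
    using convergent_add[of "\<lambda>n. step n - step 0", OF _ convergent_const[of "step 0"]] by simp
qed

definition limit_step :: real where
  "limit_step = lim step"

lemma step_tendsto: "step \<longlonglongrightarrow> limit_step"
  using convergent_step by (simp add: limit_step_def convergent_LIMSEQ_iff)

lemma limit_step_approx: "\<bar>limit_step - 0.5988890438\<bar> < 5 / 10 ^ 11"
proof -
  define l h :: real where "l = 0.5988890438 - 4 / 10 ^ 11" and "h = 0.5988890438 + 4 / 10 ^ 11"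
  have bounds: "l \<le> step k \<and> step k \<le> h" if "25 \<le> k" for k
    by (rule step_bounds[of l 25 h k]) (use that in \<open>simp_all add: step_values l_def h_def\<close>)
  have "l \<le> limit_step"
    using step_tendsto by (rule Lim_bounded2[where N = 25]) (use bounds in auto)
  moreover have "limit_step \<le> h"
    using step_tendsto by (rule Lim_bounded[where M = 25]) (use bounds in auto)
  ultimately show ?thesis
    unfolding l_def h_def abs_less_iff by simp
qed

text \<open>
  By \<open>wait_score_eq_steps\<close> the quotient is an increment plus \<open>O(1 / n)\<close>.  The shifts \<open>c\<close> and \<open>k\<close> allow one
  statement to cover \<open>P\<close>, \<open>Q\<close> and \<open>a_seq\<close>.
\<close>

lemma wait_score_growth:
  "(\<lambda>n. (wait_score n + c) / (real n + real k)) \<longlonglongrightarrow> limit_step"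
proof -
  define u where "u n = 1 / (real n + real k)" for n
  have "(\<lambda>n. 1 / real (n + k)) \<longlonglongrightarrow> 0"
    by (rule LIMSEQ_ignore_initial_segment[OF lim_1_over_n])
  then have u: "u \<longlonglongrightarrow> 0"
    by (simp add: u_def[abs_def])
  have "(\<lambda>n. (1 + (3 - real k) * u n) * step (n + 2) + (step (n + 1) + step n + (c - 3)) * u n)
      \<longlonglongrightarrow> (1 + (3 - real k) * 0) * limit_step + (limit_step + limit_step + (c - 3)) * 0"
    by (intro tendsto_intros u step_tendsto LIMSEQ_ignore_initial_segment[OF step_tendsto])
  moreover have "\<forall>\<^sub>F n in sequentially.
      (1 + (3 - real k) * u n) * step (n + 2) + (step (n + 1) + step n + (c - 3)) * u n
      = (wait_score n + c) / (real n + real k)"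
    using eventually_gt_at_top[of 0]
  proof eventually_elim
    case (elim n)
    then have "1 + (3 - real k) * u n = (real n + 3) * u n"
      by (simp add: u_def field_simps)
    then have "(1 + (3 - real k) * u n) * step (n + 2) + (step (n + 1) + step n + (c - 3)) * u n
        = ((real n + 3) * step (n + 2) + step (n + 1) + step n - 3 + c) * u n"
      by (simp only:) (simp add: algebra_simps)
    then show ?case
      by (simp only: wait_score_eq_steps[of n]) (simp add: u_def)
  qed
  ultimately show ?thesis
    by (simp add: tendsto_cong)
qed

section \<open>The game on a path\<close>

text \<open>
  Unlike the winning probability, this sum is additive over the components that a guess leaves.
\<close>

definition win_mass :: "'a rel \<Rightarrow> 'a strategy \<Rightarrow> player \<Rightarrow> 'a set \<Rightarrow> real" where
  "win_mass E \<sigma> p S = (\<Sum>x\<in>S. pmf (play E \<sigma> p S x) Exploiter)"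

lemma win_prob_eq_win_mass:
  assumes "finite S" "S \<noteq> {}"
  shows "win_prob E \<sigma> p S = win_mass E \<sigma> p S / real (card S)"
  using assms by (simp add: win_prob_def win_mass_def pmf_bind_pmf_of_set)

text \<open>
  Exchange the sum over the poisoned vertex with the expectation over the guess.  For a fixed guess \<open>g\<close>, the
  poisoned vertex \<open>g\<close> counts as a win of \<open>X\<close> exactly if \<open>R\<close> made the guess.
\<close>

lemma win_mass_rec:
  assumes "finite S" "set_pmf (guess \<sigma> p S) \<subseteq> S"
  shows "win_mass E \<sigma> p S = (\<Sum>g\<in>S. pmf (guess \<sigma> p S) g *
    (of_bool (p = Randomizer) +
      (\<Sum>x\<in>S - {g}. pmf (play E \<sigma> (opponent p) (component E (S - {g}) x) x) Exploiter)))"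
proof -
  let ?next = "\<lambda>x g. if g = x then of_bool (p = Randomizer)
    else pmf (play E \<sigma> (opponent p) (component E (S - {g}) x) x) Exploiter"
  have play: "pmf (play E \<sigma> p S x) Exploiter = (\<Sum>g\<in>S. pmf (guess \<sigma> p S) g * ?next x g)" for x
  proof -
    have "pmf (play E \<sigma> p S x) Exploiter
        = measure_pmf.expectation (guess \<sigma> p S) (\<lambda>g. pmf (if g = x \<or> g \<notin> S \<or> infinite S
            then return_pmf (opponent p)
            else play E \<sigma> (opponent p) (component E (S - {g}) x) x) Exploiter)"
      by (subst play.simps) (simp add: pmf_bind)
    also have "\<dots> = (\<Sum>g\<in>S. pmf (guess \<sigma> p S) g * pmf (if g = x \<or> g \<notin> S \<or> infinite S
            then return_pmf (opponent p)
            else play E \<sigma> (opponent p) (component E (S - {g}) x) x) Exploiter)"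
      using assms by (subst integral_measure_pmf[of S]) auto
    also have "\<dots> = (\<Sum>g\<in>S. pmf (guess \<sigma> p S) g * ?next x g)"
      using assms by (intro sum.cong) (cases p; auto)+
    finally show ?thesis .
  qed
  have "(\<Sum>x\<in>S. ?next x g) = of_bool (p = Randomizer) +
      (\<Sum>x\<in>S - {g}. pmf (play E \<sigma> (opponent p) (component E (S - {g}) x) x) Exploiter)"
    if "g \<in> S" for g
  proof -
    have "(\<Sum>x\<in>S. ?next x g) = ?next g g + (\<Sum>x\<in>S - {g}. ?next x g)"
      using assms(1) that by (rule sum.remove)
    also have "(\<Sum>x\<in>S - {g}. ?next x g)
        = (\<Sum>x\<in>S - {g}. pmf (play E \<sigma> (opponent p) (component E (S - {g}) x) x) Exploiter)"
      by (rule sum.cong) auto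
    finally show ?thesis by simp
  qed
  then show ?thesis
    unfolding win_mass_def play
    by (subst sum.swap) (simp add: sum_distrib_left[symmetric] cong: sum.cong)
qed

lemma linked_path_interval:
  assumes "u \<le> v" "{u..v} \<subseteq> S" "S \<subseteq> path_verts N"
  shows "linked (path_adj N) S u v" "linked (path_adj N) S v u"
proof -
  have edges: "(w, Suc w) \<in> path_adj N \<inter> S \<times> S" "(Suc w, w) \<in> path_adj N \<inter> S \<times> S"
    if "u \<le> w" "w < v" for w
  proof -
    have "w \<in> S" "Suc w \<in> S"
      using assms(2) that by auto
    then show "(w, Suc w) \<in> path_adj N \<inter> S \<times> S" "(Suc w, w) \<in> path_adj N \<inter> S \<times> S"
      using assms(3) by (auto simp: path_adj_def)
  qed
  have "w \<le> v \<Longrightarrow> linked (path_adj N) S u w \<and> linked (path_adj N) S w u" if "u \<le> w" for w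
    using that
  proof (induction w rule: dec_induct)
    case base
    then show ?case by (simp add: linked_def)
  next
    case (step w)
    then show ?case
      using edges[of w] unfolding linked_def
      by (auto intro: rtrancl_into_rtrancl converse_rtrancl_into_rtrancl)
  qed
  then show "linked (path_adj N) S u v" "linked (path_adj N) S v u"
    using assms(1) by auto
qed

text \<open>
  An edge of the path joins neighbouring numbers, so a walk cannot jump over a missing vertex.
\<close>

lemma linked_path_gap:
  assumes "linked (path_adj N) S u w" "g \<notin> S"
  shows "u < g \<Longrightarrow> w < g" "g < u \<Longrightarrow> g < w"
proof -
  have "(u < g \<longrightarrow> w < g) \<and> (g < u \<longrightarrow> g < w)"
    using assms(1) unfolding linked_def
  proof (induction rule: rtrancl_induct)
    case (step y z)
    then have "y \<noteq> g" "z \<noteq> g" "z = Suc y \<or> y = Suc z"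
      using assms(2) by (auto simp: path_adj_def)
    with step.IH show ?case by auto
  qed simp
  then show "u < g \<Longrightarrow> w < g" "g < u \<Longrightarrow> g < w" by auto
qed

lemma component_path:
  assumes "1 \<le> a" "b \<le> Suc N" "g \<in> {a..<b}" "x \<in> {a..<b}" "x \<noteq> g"
  shows "component (path_adj N) ({a..<b} - {g}) x = (if x < g then {a..<g} else {Suc g..<b})"
proof -
  let ?S = "{a..<b} - {g}"
  have S: "?S \<subseteq> path_verts N"
    using assms by (auto simp: path_verts_def)
  have "linked (path_adj N) ?S x w \<longleftrightarrow> (x < g \<longleftrightarrow> w < g)" if w: "w \<in> ?S" for w
  proof
    assume "linked (path_adj N) ?S x w"
    from linked_path_gap[OF this, of g] show "x < g \<longleftrightarrow> w < g"
      using assms w by (cases x g rule: linorder_cases) auto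
  next
    assume side: "x < g \<longleftrightarrow> w < g"
    show "linked (path_adj N) ?S x w"
    proof (cases "x \<le> w")
      case True
      then show ?thesis
        using side w assms by (intro linked_path_interval(1)[OF _ _ S]) auto
    next
      case False
      then show ?thesis
        using side w assms by (intro linked_path_interval(2)[OF _ _ S]) auto
    qed
  qed
  then show ?thesis
    using assms by (auto simp: component_def)
qed

text \<open>
  Half-open intervals are convenient because the two sides of a guess \<open>g\<close> in \<open>{a..<b}\<close> are then \<open>{a..<g}\<close> and
  \<open>{Suc g..<b}\<close>, including the cases in which a side is empty.
\<close>

lemma position_path_iff:
  "position (path_verts N) (path_adj N) S \<longleftrightarrow> (\<exists>a b. 1 \<le> a \<and> a < b \<and> b \<le> Suc N \<and> S = {a..<b})"
proof
  assume S: "position (path_verts N) (path_adj N) S"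
  then have sub: "S \<subseteq> {1..N}" and "S \<noteq> {}" and linked: "\<And>u v. u \<in> S \<Longrightarrow> v \<in> S \<Longrightarrow> linked (path_adj N) S u v"
    by (auto simp: position_def path_verts_def)
  then have fin: "finite S"
    using finite_subset by blast
  have ends: "Min S \<in> S" "Max S \<in> S"
    using fin \<open>S \<noteq> {}\<close> by auto
  have "v \<in> S" if "Min S \<le> v" "v \<le> Max S" for v
  proof (rule ccontr)
    assume "v \<notin> S"
    then have "Min S < v" "v < Max S"
      using that ends by (auto simp: le_less)
    then show False
      using linked_path_gap(1)[OF linked[OF ends] \<open>v \<notin> S\<close>] by simp
  qed
  then have "S = {Min S..<Suc (Max S)}"
    using fin by (auto simp: less_Suc_eq_le)
  moreover have "1 \<le> Min S" "Min S < Suc (Max S)" "Suc (Max S) \<le> Suc N"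
    using ends sub fin by (auto simp: less_Suc_eq_le)
  ultimately show "\<exists>a b. 1 \<le> a \<and> a < b \<and> b \<le> Suc N \<and> S = {a..<b}"
    by blast
next
  assume "\<exists>a b. 1 \<le> a \<and> a < b \<and> b \<le> Suc N \<and> S = {a..<b}"
  then obtain a b where ab: "1 \<le> a" "a < b" "b \<le> Suc N" and S: "S = {a..<b}"
    by blast
  have sub: "S \<subseteq> path_verts N"
    using ab S by (auto simp: path_verts_def)
  have "linked (path_adj N) S u v" if "u \<in> S" "v \<in> S" for u v
  proof (cases "u \<le> v")
    case True
    then show ?thesis
      using that S by (intro linked_path_interval(1)[OF _ _ sub]) auto
  next
    case False
    then show ?thesis
      using that S by (intro linked_path_interval(2)[OF _ _ sub]) auto
  qed
  then show "position (path_verts N) (path_adj N) S"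
    using sub ab S by (auto simp: position_def)
qed

lemma win_mass_path:
  assumes "1 \<le> a" "b \<le> Suc N" "set_pmf (guess \<sigma> p {a..<b}) \<subseteq> {a..<b}"
  shows "win_mass (path_adj N) \<sigma> p {a..<b} = (\<Sum>g\<in>{a..<b}. pmf (guess \<sigma> p {a..<b}) g *
    (of_bool (p = Randomizer) + (win_mass (path_adj N) \<sigma> (opponent p) {a..<g} +
      win_mass (path_adj N) \<sigma> (opponent p) {Suc g..<b})))"
proof -
  have "(\<Sum>x\<in>{a..<b} - {g}.
          pmf (play (path_adj N) \<sigma> (opponent p) (component (path_adj N) ({a..<b} - {g}) x) x) Exploiter)
      = win_mass (path_adj N) \<sigma> (opponent p) {a..<g} + win_mass (path_adj N) \<sigma> (opponent p) {Suc g..<b}"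
    if g: "g \<in> {a..<b}" for g
  proof -
    have "(\<Sum>x\<in>{a..<b} - {g}.
          pmf (play (path_adj N) \<sigma> (opponent p) (component (path_adj N) ({a..<b} - {g}) x) x) Exploiter)
        = (\<Sum>x\<in>{a..<g} \<union> {Suc g..<b}.
          pmf (play (path_adj N) \<sigma> (opponent p) (if x < g then {a..<g} else {Suc g..<b}) x) Exploiter)"
      using assms(1,2) g by (intro sum.cong) (auto simp: component_path)
    also have "\<dots> = win_mass (path_adj N) \<sigma> (opponent p) {a..<g}
        + win_mass (path_adj N) \<sigma> (opponent p) {Suc g..<b}"
      unfolding win_mass_def by (subst sum.union_disjoint) auto
    finally show ?thesis .
  qed
  then show ?thesis
    using assms(3) by (subst win_mass_rec) auto
qed

lemma win_mass_randomizer: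
  assumes "1 \<le> a" "a < b" "b \<le> Suc N"
  shows "win_mass (path_adj N) \<sigma> Randomizer {a..<b} = 1 + (\<Sum>g\<in>{a..<b}.
    win_mass (path_adj N) \<sigma> Exploiter {a..<g} + win_mass (path_adj N) \<sigma> Exploiter {Suc g..<b}) / real (b - a)"
  using assms
  by (subst win_mass_path) (auto simp: pmf_of_set sum.distrib add_divide_distrib sum_divide_distrib
      distrib_left simp flip: of_nat_diff)

text \<open>
  The form of \<open>wait_score_eq_sum\<close> that matches \<open>win_mass_randomizer\<close>: as \<open>g\<close> runs through the path, each of the two
  sides takes every length below \<open>b - a\<close> once.
\<close>

lemma wait_score_eq_average:
  assumes "a < b"
  shows "wait_score (b - a) = 1 + (\<Sum>g\<in>{a..<b}. move_score (g - a) + move_score (b - Suc g)) / real (b - a)"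
proof -
  have "(\<Sum>g\<in>{a..<b}. move_score (g - a)) = (\<Sum>i<b - a. move_score i)"
    by (rule sum.reindex_bij_witness[of _ "\<lambda>i. i + a" "\<lambda>g. g - a"]) auto
  moreover have "(\<Sum>g\<in>{a..<b}. move_score (b - Suc g)) = (\<Sum>i<b - a. move_score i)"
    by (rule sum.reindex_bij_witness[of _ "\<lambda>i. b - Suc i" "\<lambda>g. b - Suc g"]) auto
  ultimately show ?thesis
    using wait_score_eq_sum[of "b - a"] assms by (simp add: sum.distrib field_simps)
qed

lemma label_interval: "v \<in> {a..<b} \<Longrightarrow> label {a..<b} v = Suc v - a"
proof -
  assume "v \<in> {a..<b}"
  then have "{u \<in> {a..<b}. u \<le> v} = {a..<Suc v}"
    by auto
  then show ?thesis
    by (simp add: label_def)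
qed

lemma guess_two_interval:
  assumes "a < b"
  shows "guess_two {a..<b} = return_pmf (if b = Suc a then a else Suc a)"
proof -
  have "(THE v. v \<in> {a..<b} \<and> label {a..<b} v = (if card {a..<b} \<ge> 2 then 2 else 1))
      = (if b = Suc a then a else Suc a)"
    using assms by (intro the_equality) (auto simp: label_interval split: if_splits)
  then show ?thesis
    by (simp add: guess_two_def)
qed

lemma legal_strategy_path:
  "legal_strategy (path_verts N) (path_adj N) \<sigma> \<longleftrightarrow>
     (\<forall>a b. 1 \<le> a \<longrightarrow> a < b \<longrightarrow> b \<le> Suc N \<longrightarrow> set_pmf (\<sigma> {a..<b}) \<subseteq> {a..<b})"
  unfolding legal_strategy_def position_path_iff by blast

lemma legal_guess_two: "legal_strategy (path_verts N) (path_adj N) guess_two"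
  by (auto simp: legal_strategy_path guess_two_interval)

lemma win_mass_empty [simp]: "win_mass E \<sigma> p {} = 0"
  by (simp add: win_mass_def)

section \<open>Optimal strategies\<close>

text \<open>
  Backward induction.  When \<open>X\<close> moves, the mass is an average over the guesses of what the two sides are worth, and
  \<open>wait_score_split_le_move_score\<close> bounds every single guess.
\<close>

lemma win_mass_le_scores:
  assumes legal: "legal_strategy (path_verts N) (path_adj N) \<sigma>"
    and "1 \<le> a" "a \<le> b" "b \<le> Suc N"
  shows "win_mass (path_adj N) \<sigma> Exploiter {a..<b} \<le> move_score (b - a) \<and>
    win_mass (path_adj N) \<sigma> Randomizer {a..<b} \<le> wait_score (b - a)"
  using assms(2-)
proof (induction "b - a" arbitrary: a b rule: less_induct)
  case less
  let ?W = "win_mass (path_adj N) \<sigma>"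
  show ?case
  proof (cases "a = b")
    case True
    then show ?thesis by (simp add: move_score_def)
  next
    case False
    then have ab: "a < b"
      using less.prems by simp
    have IH: "?W Exploiter {a..<g} \<le> move_score (g - a)" "?W Randomizer {a..<g} \<le> wait_score (g - a)"
      "?W Exploiter {Suc g..<b} \<le> move_score (b - Suc g)"
      "?W Randomizer {Suc g..<b} \<le> wait_score (b - Suc g)" if "g \<in> {a..<b}" for g
      using less.hyps[of g a] less.hyps[of b "Suc g"] less.prems that by auto
    have sub: "set_pmf (\<sigma> {a..<b}) \<subseteq> {a..<b}"
      using legal ab less.prems by (auto simp: legal_strategy_path)
    have "?W Exploiter {a..<b} = (\<Sum>g\<in>{a..<b}. pmf (\<sigma> {a..<b}) g * (?W Randomizer {a..<g} + ?W Randomizer {Suc g..<b}))"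
      using less.prems sub by (subst win_mass_path) auto
    also have "\<dots> \<le> (\<Sum>g\<in>{a..<b}. pmf (\<sigma> {a..<b}) g * move_score (b - a))"
    proof (intro sum_mono mult_left_mono)
      fix g assume g: "g \<in> {a..<b}"
      then have "b - a = (g - a) + (b - Suc g) + 1"
        by auto
      then show "?W Randomizer {a..<g} + ?W Randomizer {Suc g..<b} \<le> move_score (b - a)"
        using IH(2,4)[OF g] wait_score_split_le_move_score[of "g - a" "b - Suc g"] by simp
    qed simp
    also have "\<dots> = move_score (b - a)"
      using sub by (simp add: sum_distrib_right[symmetric] sum_pmf_eq_1)
    finally have "?W Exploiter {a..<b} \<le> move_score (b - a)" .
    moreover have "?W Randomizer {a..<b} \<le> wait_score (b - a)"
      unfolding win_mass_randomizer[OF less.prems(1) ab less.prems(3)] wait_score_eq_average[OF ab]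
      using IH(1,3) by (intro add_left_mono divide_right_mono sum_mono add_mono) auto
    ultimately show ?thesis by simp
  qed
qed

text \<open>
  The hypothesis is confined to proper subintervals so that the lemma also applies inside the induction that
  establishes it for \<open>guess_two\<close>.
\<close>

lemma win_mass_randomizer_eq:
  assumes "\<And>c d. a \<le> c \<Longrightarrow> c \<le> d \<Longrightarrow> d \<le> b \<Longrightarrow> d - c < b - a \<Longrightarrow>
      win_mass (path_adj N) \<sigma> Exploiter {c..<d} = move_score (d - c)"
    and "1 \<le> a" "a \<le> b" "b \<le> Suc N"
  shows "win_mass (path_adj N) \<sigma> Randomizer {a..<b} = wait_score (b - a)"
proof (cases "a = b")
  case False
  then have ab: "a < b"
    using assms(3) by simp
  show ?thesis
    unfolding win_mass_randomizer[OF assms(2) ab assms(4)] wait_score_eq_average[OF ab]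
    using assms(1) by (intro arg_cong[of _ _ "\<lambda>s. 1 + s / real (b - a)"] sum.cong arg_cong2[of _ _ _ _ "(+)"]) auto
qed simp

lemma win_mass_guess_two:
  assumes "1 \<le> a" "a \<le> b" "b \<le> Suc N"
  shows "win_mass (path_adj N) guess_two Exploiter {a..<b} = move_score (b - a)"
  using assms
proof (induction "b - a" arbitrary: a b rule: less_induct)
  case less
  let ?W = "win_mass (path_adj N) guess_two"
  have R: "?W Randomizer {c..<d} = wait_score (d - c)" if "a \<le> c" "c \<le> d" "d \<le> b" "d - c < b - a" for c d
    using less.hyps less.prems that by (intro win_mass_randomizer_eq) auto
  show ?case
  proof (cases "a = b")
    case True
    then show ?thesis by (simp add: move_score_def)
  next
    case False
    then have ab: "a < b"
      using less.prems by simp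
    define v where "v = (if b = Suc a then a else Suc a)"
    have v: "v \<in> {a..<b}"
      using ab by (auto simp: v_def)
    have "?W Exploiter {a..<b} = (\<Sum>g\<in>{a..<b}. pmf (return_pmf v) g * (?W Randomizer {a..<g} + ?W Randomizer {Suc g..<b}))"
      using less.prems v by (subst win_mass_path) (auto simp: guess_two_interval[OF ab] v_def[symmetric])
    also have "\<dots> = (\<Sum>g\<in>{a..<b}. if g = v then ?W Randomizer {a..<v} + ?W Randomizer {Suc v..<b} else 0)"
      by (intro sum.cong) (auto simp: indicator_def)
    also have "\<dots> = ?W Randomizer {a..<v} + ?W Randomizer {Suc v..<b}"
      using v by simp
    also have "\<dots> = wait_score (v - a) + wait_score (b - Suc v)"
      using v by (intro arg_cong2[of _ _ _ _ "(+)"] R) auto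
    also have "\<dots> = move_score (b - a)"
      using ab by (auto simp: v_def move_score_def Suc_diff_Suc numeral_2_eq_2)
    finally show ?thesis .
  qed
qed

text \<open>
  The upper bound of \<open>win_mass_le_scores\<close> is attained by \<open>guess_two\<close> on all positions simultaneously, so optimality
  means attaining it everywhere.
\<close>

lemma optimal_strategy_path_iff:
  "optimal_strategy (path_verts N) (path_adj N) \<sigma> \<longleftrightarrow> legal_strategy (path_verts N) (path_adj N) \<sigma> \<and>
     (\<forall>a b. 1 \<le> a \<longrightarrow> a \<le> b \<longrightarrow> b \<le> Suc N \<longrightarrow>
        win_mass (path_adj N) \<sigma> Exploiter {a..<b} = move_score (b - a))"
proof -
  have prob: "win_prob (path_adj N) \<tau> Exploiter {a..<b}
      = win_mass (path_adj N) \<tau> Exploiter {a..<b} / real (b - a)" if "a < b" for \<tau> a b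
    using that by (simp add: win_prob_eq_win_mass)
  show ?thesis
  proof (intro iffI conjI allI impI)
    assume opt: "optimal_strategy (path_verts N) (path_adj N) \<sigma>"
    then show legal: "legal_strategy (path_verts N) (path_adj N) \<sigma>"
      by (simp add: optimal_strategy_def)
    fix a b :: nat
    assume ab: "1 \<le> a" "a \<le> b" "b \<le> Suc N"
    show "win_mass (path_adj N) \<sigma> Exploiter {a..<b} = move_score (b - a)"
    proof (cases "a = b")
      case False
      then have "a < b"
        using ab by simp
      moreover have "position (path_verts N) (path_adj N) {a..<b}"
        using ab \<open>a < b\<close> by (auto simp: position_path_iff)
      ultimately have "win_prob (path_adj N) guess_two Exploiter {a..<b}
          \<le> win_prob (path_adj N) \<sigma> Exploiter {a..<b}"
        using opt legal_guess_two[of N] by (auto simp: optimal_strategy_def)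
      then have "win_mass (path_adj N) guess_two Exploiter {a..<b}
          \<le> win_mass (path_adj N) \<sigma> Exploiter {a..<b}"
        using \<open>a < b\<close> unfolding prob[OF \<open>a < b\<close>] by (simp add: divide_le_cancel)
      then show ?thesis
        using win_mass_le_scores[OF legal ab] win_mass_guess_two[OF ab] by simp
    qed (simp add: move_score_def)
  next
    assume \<sigma>: "legal_strategy (path_verts N) (path_adj N) \<sigma> \<and>
     (\<forall>a b. 1 \<le> a \<longrightarrow> a \<le> b \<longrightarrow> b \<le> Suc N \<longrightarrow>
        win_mass (path_adj N) \<sigma> Exploiter {a..<b} = move_score (b - a))"
    have "win_prob (path_adj N) \<tau> Exploiter S \<le> win_prob (path_adj N) \<sigma> Exploiter S"
      if \<tau>: "legal_strategy (path_verts N) (path_adj N) \<tau>"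
        and S: "position (path_verts N) (path_adj N) S" for \<tau> S
    proof -
      obtain a b where ab: "1 \<le> a" "a < b" "b \<le> Suc N" "S = {a..<b}"
        using S unfolding position_path_iff by blast
      then show ?thesis
        using win_mass_le_scores[OF \<tau>, of a b] \<sigma> by (simp add: prob divide_right_mono)
    qed
    then show "optimal_strategy (path_verts N) (path_adj N) \<sigma>"
      using \<sigma> by (simp add: optimal_strategy_def)
  qed
qed

lemma optimal_guess_two: "optimal_strategy (path_verts N) (path_adj N) guess_two"
  by (simp add: optimal_strategy_path_iff legal_guess_two win_mass_guess_two)

lemma optimal_value_path:
  assumes "1 \<le> n"
  shows "P_val (path_verts n) (path_adj n) = move_score n / real n"
    and "Q_val (path_verts n) (path_adj n) = wait_score n / real n"
proof -
  have V: "path_verts n = {1..<Suc n}"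
    by (auto simp: path_verts_def)
  have vals: "win_prob (path_adj n) \<sigma> Exploiter (path_verts n) = move_score n / real n"
    "win_prob (path_adj n) \<sigma> Randomizer (path_verts n) = wait_score n / real n"
    if "optimal_strategy (path_verts n) (path_adj n) \<sigma>" for \<sigma>
    using that[unfolded optimal_strategy_path_iff] assms win_mass_randomizer_eq[of 1 "Suc n" n \<sigma>]
    by (simp_all add: V win_prob_eq_win_mass)
  show "P_val (path_verts n) (path_adj n) = move_score n / real n"
    "Q_val (path_verts n) (path_adj n) = wait_score n / real n"
    unfolding P_val_def Q_val_def optimal_value_def
    using optimal_guess_two[of n] vals by (intro the_equality; force)+
qed

text \<open>
  An optimal strategy attains the score on \<open>S\<close> as an average over its guesses of values that do not exceed the
  score.  Hence none of the guesses it makes with positive probability may be worth strictly less.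
\<close>

lemma optimal_guess_label:
  assumes opt: "optimal_strategy (path_verts N) (path_adj N) \<sigma>"
    and S: "position (path_verts N) (path_adj N) S" and "2 \<le> card S" and v: "v \<in> set_pmf (\<sigma> S)"
  shows "label S v = 2 \<or> label S v = card S - 1"
proof (rule ccontr)
  assume label: "\<not> (label S v = 2 \<or> label S v = card S - 1)"
  obtain a b where ab: "1 \<le> a" "a < b" "b \<le> Suc N" and S_eq: "S = {a..<b}"
    using S unfolding position_path_iff by blast
  let ?W = "win_mass (path_adj N) \<sigma>"
  let ?n = "b - a"
  have sub: "set_pmf (\<sigma> {a..<b}) \<subseteq> {a..<b}"
    using opt ab by (auto simp: optimal_strategy_path_iff legal_strategy_path)
  have X: "?W Exploiter {c..<d} = move_score (d - c)" if "1 \<le> c" "c \<le> d" "d \<le> Suc N" for c d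
    using opt that by (simp add: optimal_strategy_path_iff)
  have R: "?W Randomizer {c..<d} = wait_score (d - c)" if "1 \<le> c" "c \<le> d" "d \<le> Suc N" for c d
    using X that by (intro win_mass_randomizer_eq) auto
  have v_in: "v \<in> {a..<b}"
    using v sub S_eq by auto
  have parts: "?n = (g - a) + (b - Suc g) + 1" if "g \<in> {a..<b}" for g
    using that by auto
  have "move_score ?n = (\<Sum>g\<in>{a..<b}. pmf (\<sigma> {a..<b}) g * (?W Randomizer {a..<g} + ?W Randomizer {Suc g..<b}))"
    using X[of a b] win_mass_path[of a b N \<sigma> Exploiter] ab sub by simp
  also have "\<dots> = (\<Sum>g\<in>{a..<b}. pmf (\<sigma> {a..<b}) g * (wait_score (g - a) + wait_score (b - Suc g)))"
    using ab by (intro sum.cong) (auto simp: R)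
  also have "\<dots> < (\<Sum>g\<in>{a..<b}. pmf (\<sigma> {a..<b}) g * move_score ?n)"
  proof (rule sum_strict_mono_ex1)
    show "\<forall>g\<in>{a..<b}. pmf (\<sigma> {a..<b}) g * (wait_score (g - a) + wait_score (b - Suc g))
        \<le> pmf (\<sigma> {a..<b}) g * move_score ?n"
      using wait_score_split_le_move_score parts by (intro ballI mult_left_mono) (metis, simp)
    have "v - a \<noteq> 1" "b - Suc v \<noteq> 1" "1 \<le> (v - a) + (b - Suc v)"
      using label v_in assms(3) by (auto simp: S_eq label_interval)
    then have "wait_score (v - a) + wait_score (b - Suc v) < move_score ?n"
      using wait_score_split_less_move_score[of "v - a" "b - Suc v"] parts[OF v_in] by simp
    then have "pmf (\<sigma> {a..<b}) v * (wait_score (v - a) + wait_score (b - Suc v))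
        < pmf (\<sigma> {a..<b}) v * move_score ?n"
      using v S_eq by (intro mult_strict_left_mono) (auto simp: pmf_positive)
    then show "\<exists>g\<in>{a..<b}. pmf (\<sigma> {a..<b}) g * (wait_score (g - a) + wait_score (b - Suc g))
        < pmf (\<sigma> {a..<b}) g * move_score ?n"
      using v_in by blast
  qed simp
  also have "\<dots> = move_score ?n"
    using sub by (simp add: sum_distrib_right[symmetric] sum_pmf_eq_1)
  finally show False by simp
qed

section \<open>The limits\<close>

text \<open>
  The factor \<open>n + 1\<close> of \<open>n\<^sup>2 + 7 * n + 6 = (n + 1) * (n + 6)\<close> cancels, because \<open>s_seq n\<close> is the sum of move scores
  that determines \<open>wait_score (n + 1)\<close>.
\<close>

lemma a_seq_eq: "2 * a_seq n = (wait_score (n + 1) + 3) / (real (n + 1) + real 5)"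
proof -
  have "real i * p_seq i = move_score i" for i
  proof (cases "i = 0")
    case False
    have V: "path_verts i = {1..<Suc i}"
      by (auto simp: path_verts_def)
    show ?thesis
      using False win_mass_guess_two[of 1 "Suc i" i] by (simp add: p_seq_def V win_prob_eq_win_mass)
  qed (simp add: move_score_def)
  then have "s_seq n = (\<Sum>i=1..n. move_score i)"
    by (simp add: s_seq_def)
  also have "\<dots> = (\<Sum>i<n + 1. move_score i)"
    by (rule sum.mono_neutral_left) (auto simp: move_score_def)
  finally have s: "2 * s_seq n = (real n + 1) * (wait_score (n + 1) - 1)"
    using wait_score_eq_sum[of "n + 1"] by (simp add: algebra_simps)
  have "2 * a_seq n = (2 * s_seq n + 4 * (real n + 1)) / ((real n)\<^sup>2 + 7 * real n + 6)"
    by (simp add: a_seq_def add_divide_distrib)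
  also have "\<dots> = ((real n + 1) * (wait_score (n + 1) + 3)) / ((real n + 1) * (real n + 6))"
    unfolding s by (simp add: algebra_simps power2_eq_square)
  also have "\<dots> = (wait_score (n + 1) + 3) / (real n + 6)"
    by (subst mult_divide_mult_cancel_left) auto
  finally show ?thesis by simp
qed

lemma a_seq_tendsto: "a_seq \<longlonglongrightarrow> limit_step / 2"
proof -
  have "(\<lambda>n. 2 * a_seq n) \<longlonglongrightarrow> limit_step"
    unfolding a_seq_eq by (rule LIMSEQ_ignore_initial_segment[OF wait_score_growth])
  then have "(\<lambda>n. (2 * a_seq n) / 2) \<longlonglongrightarrow> limit_step / 2"
    by (intro tendsto_divide) auto
  then show ?thesis by simp
qed

lemma P_val_tendsto: "(\<lambda>n. P_val (path_verts n) (path_adj n)) \<longlonglongrightarrow> limit_step"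
proof (rule LIMSEQ_offset[where k = 2])
  show "(\<lambda>n. P_val (path_verts (n + 2)) (path_adj (n + 2))) \<longlonglongrightarrow> limit_step"
    using wait_score_growth[of 1 2] by (simp add: optimal_value_path move_score_def add.commute)
qed

lemma Q_val_tendsto: "(\<lambda>n. Q_val (path_verts n) (path_adj n)) \<longlonglongrightarrow> limit_step"
proof (rule Lim_transform_eventually)
  show "(\<lambda>n. (wait_score n + 0) / (real n + real 0)) \<longlonglongrightarrow> limit_step"
    by (rule wait_score_growth)
  show "\<forall>\<^sub>F n in sequentially. (wait_score n + 0) / (real n + real 0) = Q_val (path_verts n) (path_adj n)"
    using eventually_ge_at_top[of 1] by eventually_elim (simp add: optimal_value_path)
qed

theorem theorem1p2:
  shows "(\<forall>(N::nat) \<sigma> S v.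
            optimal_strategy (path_verts N) (path_adj N) \<sigma> \<longrightarrow>
            position (path_verts N) (path_adj N) S \<longrightarrow> card S \<ge> 2 \<longrightarrow>
            v \<in> set_pmf (\<sigma> S) \<longrightarrow> label S v = 2 \<or> label S v = card S - 1)
       \<and> convergent a_seq
       \<and> (\<lambda>n. P_val (path_verts n) (path_adj n)) \<longlonglongrightarrow> 2 * lim a_seq
       \<and> (\<lambda>n. Q_val (path_verts n) (path_adj n)) \<longlonglongrightarrow> 2 * lim a_seq
       \<and> \<bar>2 * lim a_seq - 0.5988890438\<bar> < 5 / 10 ^ 11"
proof -
  have "2 * lim a_seq = limit_step"
    using limI[OF a_seq_tendsto] by simp
  moreover have "convergent a_seq"
    using a_seq_tendsto by (rule convergentI)
  ultimately show ?thesis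
    using optimal_guess_label P_val_tendsto Q_val_tendsto limit_step_approx by simp
qed

end
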